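(* Let $n,m\ge 1$ and $1\le k\le n$ be integers, let $\lambda>0$ and $L>0$, and let $u:[0,1]^{n\times m}\to\mathbb{R}^n$ be a $\lambda$-Lipschitz utility function. The worst-case regret of the Clipped Linear Lottery with utility $u$, Lipschitz constant $\lambda$, smoothness parameter $L$ and budget $k$ satisfies $$\max_{X\in[0,1]^{n\times m}}\mathrm{Regret}(X)\;\le\;\frac{k\left(1-\frac{k}{n}\right)\lambda}{2L}.$$
   Context: $X\in[0,1]^{n\times m}$ is a review matrix and $\|A\|_{1,1}=\sum_{i,j}|A_{i,j}|$. A utility function $u:[0,1]^{n\times m}\to\mathbb{R}^n$ is $\lambda$-Lipschitz if $\|u(X)-u(X')\|_1\le\lambda\|X-X'\|_{1,1}$ for all $X,X'$. Clipped Linear Lottery: let $\mathrm{clip}_{[0,1]}(x)=\min\{1,\max\{0,x\}\}$ and slope $a=L/(2\lambda)$. Given $X$, let $b\in\mathbb{R}$ be an intercept with $\sum_{i=1}^n\mathrm{clip}_{[0,1]}(a\,u_i(X)+b)=k$ (such $b$ exists and the resulting vector of clipped values does not depend on the choice of $b$). The rule selects a random size-$k$ subset of $\{1,\dots,n\}$ whose marginal inclusion probabilities are $p_i(X)=\mathrm{clip}_{[0,1]}(a\,u_i(X)+b)$. Regret: $\mathrm{Regret}(X)=\mathrm{OPT}(X)-p(X)^\top u(X)$, where $\mathrm{OPT}(X)$ is the sum of the $k$ largest entries of $u(X)$. *)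

theory Defs
  imports "HOL-Probability.Probability"
begin

definition review_matrices :: "(real^'m^'n) set" where
  "review_matrices = {X. \<forall>i j. X $ i $ j \<in> {0..1}}"

definition norm1 :: "real^'n \<Rightarrow> real" where
  "norm1 v = (\<Sum>i\<in>UNIV. \<bar>v $ i\<bar>)"

definition norm11 :: "real^'m^'n \<Rightarrow> real" where
  "norm11 A = (\<Sum>i\<in>UNIV. \<Sum>j\<in>UNIV. \<bar>A $ i $ j\<bar>)"

text \<open>
  Utilities are total functions in HOL; only their values on \<open>review_matrices\<close> are ever
  constrained or used.
\<close>

definition lipschitz_utility :: "real \<Rightarrow> (real^'m^'n \<Rightarrow> real^'n) \<Rightarrow> bool" where
  "lipschitz_utility lam u \<longleftrightarrow>
     (\<forall>X\<in>review_matrices. \<forall>X'\<in>review_matrices. norm1 (u X - u X') \<le> lam * norm11 (X - X'))"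

definition clip01 :: "real \<Rightarrow> real" where
  "clip01 x = min 1 (max 0 x)"

definition inclusion_probs :: "'n::finite set pmf \<Rightarrow> real^'n" where
  "inclusion_probs q = (\<chi> i. measure_pmf.prob q {S. i \<in> S})"

text \<open>
  A selection rule maps a review matrix to a distribution on sets of selected indices. The
  Clipped Linear Lottery is specified only through its inclusion probabilities, so it is
  rendered as a predicate on selection rules; \<open>clipped_linear_lottery_exists\<close>
  below shows that the specification can be met.
\<close>

definition clipped_linear_lottery ::
  "(real^'m^'n \<Rightarrow> real^'n) \<Rightarrow> real \<Rightarrow> real \<Rightarrow> nat \<Rightarrow> (real^'m^'n \<Rightarrow> 'n::finite set pmf) \<Rightarrow> bool"
  where
  "clipped_linear_lottery u lam L k rule \<longleftrightarrow>
     (\<forall>X\<in>review_matrices.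
        (\<forall>S\<in>set_pmf (rule X). card S = k) \<and>
        (\<exists>b. (\<Sum>i\<in>UNIV. clip01 (L / (2 * lam) * u X $ i + b)) = real k \<and>
             (\<forall>i. inclusion_probs (rule X) $ i = clip01 (L / (2 * lam) * u X $ i + b))))"

text \<open>Entries are counted with multiplicity.\<close>

definition sum_largest :: "nat \<Rightarrow> real^'n \<Rightarrow> real" where
  "sum_largest k v =
     sum_list (take k (rev (sorted_list_of_multiset (image_mset (($) v) (mset_set UNIV)))))"

definition regret ::
  "(real^'m^'n \<Rightarrow> real^'n) \<Rightarrow> nat \<Rightarrow> (real^'m^'n \<Rightarrow> 'n::finite set pmf) \<Rightarrow> real^'m^'n \<Rightarrow> real"
  where
  "regret u k rule X = sum_largest k (u X) - inclusion_probs (rule X) \<bullet> u X"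

lemma intercept_exists:
  fixes v :: "'n::finite \<Rightarrow> real"
  assumes "k \<le> CARD('n)"
  shows "\<exists>b. (\<Sum>i\<in>UNIV. clip01 (v i + b)) = real k"
proof -
  define M where "M = (\<Sum>i\<in>UNIV. \<bar>v i\<bar>)"
  have bnd: "\<bar>v i\<bar> \<le> M" for i
    unfolding M_def by (rule member_le_sum) auto
  have M0: "0 \<le> M" unfolding M_def by (simp add: sum_nonneg)
  have lo: "clip01 (v i + (- M)) = 0" for i
    using bnd[of i] by (auto simp: clip01_def)
  have hi: "clip01 (v i + (M + 1)) = 1" for i
    using bnd[of i] by (auto simp: clip01_def)
  have "\<exists>b. - M \<le> b \<and> b \<le> M + 1 \<and> (\<Sum>i\<in>UNIV. clip01 (v i + b)) = real k"
  proof (rule IVT')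
    show "(\<Sum>i\<in>UNIV. clip01 (v i + (- M))) \<le> real k" using lo by simp
    show "real k \<le> (\<Sum>i\<in>UNIV. clip01 (v i + (M + 1)))" using hi assms by simp
    show "- M \<le> M + 1" using M0 by simp
    show "continuous_on {- M..M + 1} (\<lambda>b. \<Sum>i\<in>UNIV. clip01 (v i + b))"
      unfolding clip01_def by (intro continuous_intros)
  qed
  then show ?thesis by blast
qed

text \<open>
  Rounding: a fractional vector with integral sum is a mixture of two vectors with fewer
  fractional entries, obtained by moving mass between two fractional coordinates.
\<close>

lemma fixed_size_pmf_exists:
  fixes p :: "'n::finite \<Rightarrow> real"
  assumes "\<And>i. 0 \<le> p i" "\<And>i. p i \<le> 1" "(\<Sum>i\<in>UNIV. p i) = real k"
  shows "\<exists>q. (\<forall>S\<in>set_pmf q. card S = k) \<and> (\<forall>i. measure_pmf.prob q {S. i \<in> S} = p i)"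
  using assms
proof (induction "card {i. p i \<noteq> 0 \<and> p i \<noteq> 1}" arbitrary: p rule: less_induct)
  case less
  show ?case
  proof (cases "{i. p i \<noteq> 0 \<and> p i \<noteq> 1} = {}")
    case True
    define S where "S = {i. p i = 1}"
    have ind: "p i = indicator S i" for i
      using True by (auto simp: S_def indicator_def)
    have "real (card S) = real k"
      using less.prems(3) by (simp add: ind indicator_def)
    then have "card S = k" by simp
    then show ?thesis
      by (intro exI[of _ "return_pmf S"]) (auto simp: ind indicator_def)
  next
    case False
    then obtain i where i: "p i \<noteq> 0" "p i \<noteq> 1" by blast
    have "\<exists>j. j \<noteq> i \<and> p j \<noteq> 0 \<and> p j \<noteq> 1"
    proof (rule ccontr)
      assume "\<not> ?thesis"
      then have "\<And>j. j \<in> UNIV - {i} \<Longrightarrow> p j \<in> \<int>" by auto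
      then have "(\<Sum>j\<in>UNIV - {i}. p j) \<in> \<int>" by (rule Ints_sum)
      moreover have "p i = real k - (\<Sum>j\<in>UNIV - {i}. p j)"
        using less.prems(3) by (simp add: sum.remove[of UNIV i])
      ultimately have "p i \<in> \<int>" by simp
      then obtain z where z: "p i = of_int z" by (auto elim: Ints_cases)
      have "0 \<le> z" "z \<le> 1"
        using less.prems(1,2)[of i] z by auto
      then have "z = 0 \<or> z = 1" by linarith
      then show False using i z by auto
    qed
    then obtain j where j: "j \<noteq> i" "p j \<noteq> 0" "p j \<noteq> 1" by blast
    have pi: "0 < p i" "p i < 1" and pj: "0 < p j" "p j < 1"
      using less.prems(1,2)[of i] less.prems(1,2)[of j] i j by auto
    define shift where "shift e = p(i := p i + e, j := p j - e)" for e :: real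
    have rec: "\<exists>q. (\<forall>S\<in>set_pmf q. card S = k) \<and>
        (\<forall>l. measure_pmf.prob q {S. l \<in> S} = shift e l)"
      if e: "0 \<le> p i + e" "p i + e \<le> 1" "0 \<le> p j - e" "p j - e \<le> 1"
        "p i + e \<in> {0, 1} \<or> p j - e \<in> {0, 1}" for e
    proof (rule less.hyps)
      show "card {l. shift e l \<noteq> 0 \<and> shift e l \<noteq> 1} < card {l. p l \<noteq> 0 \<and> p l \<noteq> 1}"
      proof (rule psubset_card_mono)
        have "{l. shift e l \<noteq> 0 \<and> shift e l \<noteq> 1} \<subseteq> {l. p l \<noteq> 0 \<and> p l \<noteq> 1}"
          using i j by (auto simp: shift_def split: if_splits)
        moreover have "{l. shift e l \<noteq> 0 \<and> shift e l \<noteq> 1} \<noteq> {l. p l \<noteq> 0 \<and> p l \<noteq> 1}"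
        proof -
          have "i \<notin> {l. shift e l \<noteq> 0 \<and> shift e l \<noteq> 1} \<or> j \<notin> {l. shift e l \<noteq> 0 \<and> shift e l \<noteq> 1}"
            using e(5) j(1) by (auto simp: shift_def)
          then show ?thesis using i j by blast
        qed
        ultimately show "{l. shift e l \<noteq> 0 \<and> shift e l \<noteq> 1} \<subset> {l. p l \<noteq> 0 \<and> p l \<noteq> 1}" by blast
      qed simp
      show "0 \<le> shift e l" "shift e l \<le> 1" for l
        using e less.prems(1,2)[of l] by (auto simp: shift_def)
      have "(\<Sum>l\<in>UNIV. shift e l) = (\<Sum>l\<in>UNIV. p l + (if l = i then e else 0) - (if l = j then e else 0))"
        using j(1) by (intro sum.cong) (auto simp: shift_def)
      also have "\<dots> = real k"
        using less.prems(3) by (simp add: sum.distrib sum_subtractf)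
      finally show "(\<Sum>l\<in>UNIV. shift e l) = real k" .
    qed
    define d where "d = min (1 - p i) (p j)"
    define c where "c = min (p i) (1 - p j)"
    have dc: "0 < d" "0 < c" using pi pj by (auto simp: d_def c_def)
    have "\<exists>q. (\<forall>S\<in>set_pmf q. card S = k) \<and>
        (\<forall>l. measure_pmf.prob q {S. l \<in> S} = shift (d) l)"
      using pi pj by (intro rec) (auto simp: d_def min_def)
    then obtain q1 where q1: "\<forall>S\<in>set_pmf q1. card S = k"
        "\<And>l. measure_pmf.prob q1 {S. l \<in> S} = shift d l"
      by blast
    have "\<exists>q. (\<forall>S\<in>set_pmf q. card S = k) \<and>
        (\<forall>l. measure_pmf.prob q {S. l \<in> S} = shift (- c) l)"
      using pi pj by (intro rec) (auto simp: c_def min_def)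
    then obtain q2 where q2: "\<forall>S\<in>set_pmf q2. card S = k"
        "\<And>l. measure_pmf.prob q2 {S. l \<in> S} = shift (- c) l"
      by blast
    define t where "t = c / (c + d)"
    have t: "0 \<le> t" "t \<le> 1" "t * d = (1 - t) * c"
      using dc by (auto simp: t_def field_simps)
    define q where "q = bind_pmf (bernoulli_pmf t) (\<lambda>x. if x then q1 else q2)"
    have "\<forall>S\<in>set_pmf q. card S = k"
      using q1(1) q2(1) by (auto simp: q_def split: if_splits)
    moreover have "measure_pmf.prob q {S. l \<in> S} = p l" for l
    proof -
      have as_map: "measure_pmf.prob r {S. l \<in> S} = pmf (map_pmf (\<lambda>S. l \<in> S) r) True"
        for r :: "'n set pmf"
        by (simp add: pmf_map vimage_def)
      have "measure_pmf.prob q {S. l \<in> S}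
          = pmf (bernoulli_pmf t \<bind> (\<lambda>x. map_pmf (\<lambda>S. l \<in> S) (if x then q1 else q2))) True"
        unfolding as_map q_def map_bind_pmf ..
      also have "\<dots> = t * pmf (map_pmf (\<lambda>S. l \<in> S) q1) True
          + (1 - t) * pmf (map_pmf (\<lambda>S. l \<in> S) q2) True"
        using t by (simp add: pmf_bind)
      also have "\<dots> = t * shift d l + (1 - t) * shift (- c) l"
        using q1(2) q2(2) by (simp flip: as_map)
      also have "\<dots> = p l"
      proof -
        have "t * (x + d) + (1 - t) * (x - c) = x" "t * (x - d) + (1 - t) * (x + c) = x" for x
          using t(3) by (simp_all add: algebra_simps)
        then show ?thesis using j(1) by (simp add: shift_def algebra_simps)
      qed
      finally show ?thesis .
    qed
    ultimately show ?thesis by blast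
  qed
qed

lemma clipped_linear_lottery_exists:
  fixes u :: "real^'m^'n \<Rightarrow> real^'n"
  assumes "k \<le> CARD('n)"
  shows "\<exists>rule. clipped_linear_lottery u lam L k rule"
proof -
  have "\<exists>q :: 'n set pmf. (\<forall>S\<in>set_pmf q. card S = k) \<and>
      (\<exists>b. (\<Sum>i\<in>UNIV. clip01 (L / (2 * lam) * u X $ i + b)) = real k \<and>
           (\<forall>i. inclusion_probs q $ i = clip01 (L / (2 * lam) * u X $ i + b)))" for X
  proof -
    obtain b where b: "(\<Sum>i\<in>UNIV. clip01 (L / (2 * lam) * u X $ i + b)) = real k"
      using intercept_exists[OF assms, of "\<lambda>i. L / (2 * lam) * u X $ i"] by blast
    obtain q :: "'n set pmf" where "\<forall>S\<in>set_pmf q. card S = k"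
      "\<forall>i. measure_pmf.prob q {S. i \<in> S} = clip01 (L / (2 * lam) * u X $ i + b)"
      using fixed_size_pmf_exists[of "\<lambda>i. clip01 (L / (2 * lam) * u X $ i + b)" k] b
      by (auto simp: clip01_def)
    then show ?thesis using b by (auto simp: inclusion_probs_def)
  qed
  then show ?thesis unfolding clipped_linear_lottery_def by meson
qed

end

theory Submission imports Defs begin

text \<open>
  With slope \<open>a\<close> and \<open>v = u X\<close>, the clipped vector \<open>p\<close> is the projection of
  \<open>a v + b\<close> to the unit cube, so \<open>(q - p) \<bullet> (a v + b - p) \<le> 0\<close> for every \<open>q\<close> in the cube. If
  \<open>q\<close> also has coordinate sum \<open>k\<close>, the intercept drops out and
  \<open>a (q - p) \<bullet> v \<le> p \<bullet> (q - p)\<close>. Centring at the constant vector \<open>r = k / n\<close>, the right-hand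
  side equals \<open>(p - r) \<bullet> (q - r) - (p - r) \<bullet> (p - r)\<close>, which is at most a quarter of
  \<open>(q - r) \<bullet> (q - r)\<close>, and for the indicator of the \<open>k\<close> best entries this is \<open>k (1 - k / n) / 4\<close>.
  The maximum is attained since the review matrices are compact and the regret is continuous: the
  sum of the \<open>k\<close> largest entries is Lipschitz, and so is \<open>p\<close> as a function of \<open>v\<close>, because
  clipping is firmly nonexpansive and both clipped vectors have the same sum.
\<close>

section \<open>The sum of the largest entries\<close>

text \<open>Subtract the threshold \<theta>, the least value of \<open>f\<close> on
  \<open>T\<close>: terms outside \<open>T\<close> become nonpositive and terms in \<open>T\<close>
  nonnegative. Equal cardinalities make the total shift the same on both sides.\<close>

lemma sum_le_sum_dominating:
  fixes f :: "'a \<Rightarrow> real"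
  assumes "finite S" "finite T" "card S = card T"
    and dom: "\<And>i j. i \<in> T \<Longrightarrow> j \<notin> T \<Longrightarrow> f j \<le> f i"
  shows "sum f S \<le> sum f T"
proof (cases "T = {}")
  case True
  then show ?thesis using assms by auto
next
  case False
  define \<theta> where "\<theta> = Min (f ` T)"
  have in_T: "\<theta> \<le> f i" if "i \<in> T" for i
    using assms(2) that by (simp add: \<theta>_def)
  have "\<theta> \<in> f ` T" unfolding \<theta>_def using assms(2) False by (intro Min_in) auto
  then have notin_T: "f j \<le> \<theta>" if "j \<notin> T" for j
    using dom that by auto
  have "(\<Sum>i\<in>S. f i - \<theta>) = (\<Sum>i\<in>S \<inter> T. f i - \<theta>) + (\<Sum>i\<in>S - T. f i - \<theta>)"
    using assms(1) by (rule sum.Int_Diff)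
  also have "\<dots> \<le> (\<Sum>i\<in>S \<inter> T. f i - \<theta>)"
    using notin_T by (auto intro!: sum_nonpos)
  also have "\<dots> \<le> (\<Sum>i\<in>T. f i - \<theta>)"
    using assms(2) in_T by (intro sum_mono2) auto
  finally show ?thesis using assms(3) by (simp add: sum_subtractf)
qed

lemma sum_largest_attained:
  fixes v :: "real^'n"
  assumes "k \<le> CARD('n)"
  obtains T where "card T = k" "sum_largest k v = (\<Sum>i\<in>T. v $ i)"
    "\<And>S. card S = k \<Longrightarrow> (\<Sum>i\<in>S. v $ i) \<le> (\<Sum>i\<in>T. v $ i)"
proof -
  obtain ys :: "'n list" where ys: "set ys = UNIV" "distinct ys"
    using finite_distinct_list[of "UNIV :: 'n set"] by auto
  \<comment> \<open>Sorting indices by their entries, rather than the entries themselves, turns the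
    list of largest values into a set \<open>T\<close> of indices, with ties broken by list
    order.\<close>
  define xs where "xs = rev (sort_key (($) v) ys)"
  have xs: "set xs = UNIV" "distinct xs" using ys by (auto simp: xs_def)
  have len: "length xs = CARD('n)" using xs distinct_card by metis
  have "mset_set UNIV = mset ys" using ys by (metis mset_set_set)
  then have "sorted_list_of_multiset (image_mset (($) v) (mset_set UNIV)) = sort (map (($) v) ys)"
    by (simp flip: mset_map)
  also have "\<dots> = map (($) v) (sort_key (($) v) ys)"
    by (rule properties_for_sort) auto
  finally have largest: "sum_largest k v = sum_list (take k (map (($) v) xs))"
    unfolding sum_largest_def xs_def by (simp add: rev_map)
  have sorted: "sorted_wrt (\<lambda>i j. v $ j \<le> v $ i) (take k xs @ drop k xs)"
  proof -
    have "sorted (map (($) v) (sort_key (($) v) ys))" by simp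
    then show ?thesis by (simp add: xs_def sorted_wrt_rev sorted_wrt_map)
  qed
  define T where "T = set (take k xs)"
  have card: "card T = k"
    using xs len assms by (simp add: T_def distinct_card)
  show thesis
  proof (rule that)
    show "card T = k" by (fact card)
    show "sum_largest k v = (\<Sum>i\<in>T. v $ i)"
      using xs unfolding largest T_def by (simp add: take_map sum_list_distinct_conv_sum_set)
    fix S :: "'n set" assume S: "card S = k"
    have dom: "v $ j \<le> v $ i" if "i \<in> T" "j \<notin> T" for i j
    proof -
      have "j \<in> set (take k xs) \<union> set (drop k xs)"
        unfolding set_append[symmetric] append_take_drop_id using xs by simp
      then have "j \<in> set (drop k xs)" using that(2) by (auto simp: T_def)
      then show ?thesis using sorted that(1) unfolding sorted_wrt_append T_def by blast
    qed
    show "(\<Sum>i\<in>S. v $ i) \<le> (\<Sum>i\<in>T. v $ i)"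
      by (rule sum_le_sum_dominating) (auto simp: S card dom)
  qed
qed

text \<open>An index set that is optimal for \<open>v\<close> is still a competitor for
  \<open>w\<close>.\<close>

lemma sum_largest_diff_le:
  fixes v w :: "real^'n"
  assumes "k \<le> CARD('n)"
  shows "sum_largest k v - sum_largest k w \<le> norm1 (v - w)"
proof -
  obtain T where T: "card T = k" "sum_largest k v = (\<Sum>i\<in>T. v $ i)"
    using sum_largest_attained[OF assms] by metis
  have "(\<Sum>i\<in>T. w $ i) \<le> sum_largest k w"
    using sum_largest_attained[OF assms, of w] T(1) by metis
  then have "sum_largest k v - sum_largest k w \<le> (\<Sum>i\<in>T. v $ i - w $ i)"
    using T(2) by (simp add: sum_subtractf)
  also have "\<dots> \<le> (\<Sum>i\<in>T. \<bar>(v - w) $ i\<bar>)" by (intro sum_mono) auto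
  also have "\<dots> \<le> norm1 (v - w)" unfolding norm1_def by (intro sum_mono2) auto
  finally show ?thesis .
qed

lemma continuous_on_sum_largest:
  assumes "k \<le> CARD('n)"
  shows "continuous_on A (sum_largest k :: real^'n \<Rightarrow> real)"
  unfolding continuous_on_def
proof (intro ballI)
  fix v :: "real^'n"
  have "((\<lambda>w. norm1 (w - v)) \<longlongrightarrow> norm1 (v - v)) (at v within A)"
    unfolding norm1_def by (intro tendsto_intros)
  then have lim: "((\<lambda>w. norm1 (w - v)) \<longlongrightarrow> 0) (at v within A)" by (simp add: norm1_def)
  have "norm1 (v - w) = norm1 (w - v)" for w
    unfolding norm1_def by (simp add: abs_minus_commute)
  then have "norm (sum_largest k w - sum_largest k v) \<le> norm1 (w - v)" for w
    using sum_largest_diff_le[OF assms, of v w] sum_largest_diff_le[OF assms, of w v]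
    by (auto simp: abs_le_iff)
  then have "((\<lambda>w. sum_largest k w - sum_largest k v) \<longlongrightarrow> 0) (at v within A)"
    by (intro Lim_null_comparison[OF _ lim]) (simp add: always_eventually)
  then show "(sum_largest k \<longlongrightarrow> sum_largest k v) (at v within A)" by (rule Lim_null[THEN iffD2])
qed

section \<open>Clipped vectors\<close>

text \<open>The variational inequality of the projection to the unit interval: the second factor
  vanishes if \<open>x\<close> is inside, and otherwise it points away from the interval.\<close>

lemma clip01_projection:
  assumes "0 \<le> q" "q \<le> 1"
  shows "(q - clip01 x) * (x - clip01 x) \<le> 0"
  using assms by (auto simp: clip01_def min_def max_def mult_le_0_iff)

text \<open>Add two projection inequalities, each tested against the other clipped value.\<close>

lemma clip01_firmly_nonexpansive:
  "(clip01 x - clip01 y)\<^sup>2 \<le> (clip01 x - clip01 y) * (x - y)"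
proof -
  have "0 \<le> clip01 z" "clip01 z \<le> 1" for z by (auto simp: clip01_def)
  then have "(clip01 y - clip01 x) * (x - clip01 x) \<le> 0" "(clip01 x - clip01 y) * (y - clip01 y) \<le> 0"
    by (auto intro: clip01_projection)
  then show ?thesis by (simp add: power2_eq_square algebra_simps)
qed

text \<open>The intercepts \<open>b\<close> and \<open>c\<close> may differ: equal sums cancel the
  \<open>b - c\<close> term, and Cauchy-Schwarz does the rest. For \<open>v = w\<close> this gives
  independence of the intercept.\<close>

lemma clipped_lipschitz:
  fixes v w p q :: "real^'n"
  assumes "0 \<le> a"
    and p: "\<And>i. p $ i = clip01 (a * v $ i + b)" and q: "\<And>i. q $ i = clip01 (a * w $ i + c)"
    and sums: "(\<Sum>i\<in>UNIV. p $ i) = (\<Sum>i\<in>UNIV. q $ i)"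
  shows "norm (p - q) \<le> a * norm (v - w)"
proof -
  have "(norm (p - q))\<^sup>2 = (\<Sum>i\<in>UNIV. (p $ i - q $ i)\<^sup>2)"
    unfolding power2_norm_eq_inner inner_vec_def by (simp add: power2_eq_square)
  also have "\<dots> \<le> (\<Sum>i\<in>UNIV. (p $ i - q $ i) * ((a * v $ i + b) - (a * w $ i + c)))"
    unfolding p q by (intro sum_mono clip01_firmly_nonexpansive)
  also have "\<dots> = (\<Sum>i\<in>UNIV. a * ((p $ i - q $ i) * (v $ i - w $ i)) + (b - c) * (p $ i - q $ i))"
    by (intro sum.cong) (auto simp: algebra_simps)
  also have "\<dots> = a * ((p - q) \<bullet> (v - w)) + (b - c) * (\<Sum>i\<in>UNIV. p $ i - q $ i)"
    unfolding inner_vec_def by (simp add: sum.distrib sum_distrib_left)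
  also have "\<dots> = a * ((p - q) \<bullet> (v - w))" using sums by (simp add: sum_subtractf)
  also have "\<dots> \<le> a * (norm (p - q) * norm (v - w))"
    using assms(1) by (intro mult_left_mono norm_cauchy_schwarz)
  finally have *: "norm (p - q) * norm (p - q) \<le> norm (p - q) * (a * norm (v - w))"
    by (simp add: power2_eq_square algebra_simps)
  show ?thesis
  proof (cases "norm (p - q) = 0")
    case True
    then show ?thesis using assms(1) by simp
  next
    case False
    then have "0 < norm (p - q)" by simp
    then show ?thesis using * mult_le_cancel_left_pos by blast
  qed
qed

lemma clipped_regret_bound:
  fixes v p :: "real^'n"
  assumes "0 < a" and "card T = k"
    and p: "\<And>i. p $ i = clip01 (a * v $ i + b)" and sum_p: "(\<Sum>i\<in>UNIV. p $ i) = real k"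
  shows "(\<Sum>i\<in>T. v $ i) - p \<bullet> v \<le> real k * (1 - real k / real CARD('n)) / (4 * a)"
proof -
  define n where "n = real CARD('n)"
  define r where "r = real k / n"
  define q where "q i = (if i \<in> T then 1 else 0 :: real)" for i
  have n: "0 < n" by (simp add: n_def)
  have sum_q: "(\<Sum>i\<in>UNIV. q i) = real k" using assms(2) by (simp add: q_def sum.If_cases)
  have sum_qv: "(\<Sum>i\<in>UNIV. q i * v $ i) = (\<Sum>i\<in>T. v $ i)"
    by (simp add: q_def sum.If_cases if_distrib if_distribR cong: if_cong)
  \<comment> \<open>As \<open>q i\<close> is 0 or 1, the first two terms on the right are a quarter
    of the square of \<open>q i - r\<close>. The last term vanishes on summation, since
    \<open>p\<close> and \<open>q\<close> both sum to \<open>k\<close>.\<close>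
  have pointwise: "a * ((q i - p $ i) * v $ i) \<le> (1 - 2 * r) / 4 * q i + r\<^sup>2 / 4 + (r - b) * (q i - p $ i)"
    for i
  proof -
    have "(q i - p $ i) * (a * v $ i + b - p $ i) \<le> 0"
      unfolding p by (rule clip01_projection) (auto simp: q_def)
    \<comment> \<open>Completing the square absorbs \<open>(p $ i - r) * (q i - r)\<close> minus the
      square of \<open>p $ i - r\<close>.\<close>
    moreover have "0 \<le> ((q i - r) / 2 - (p $ i - r))\<^sup>2" by simp
    ultimately show ?thesis
      by (cases "i \<in> T") (simp_all add: q_def power2_eq_square field_simps)
  qed
  have "a * ((\<Sum>i\<in>T. v $ i) - p \<bullet> v) = (\<Sum>i\<in>UNIV. a * ((q i - p $ i) * v $ i))"
    unfolding inner_vec_def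
    by (simp add: sum_qv left_diff_distrib sum_subtractf flip: sum_distrib_left)
  also have "\<dots> \<le> (\<Sum>i\<in>UNIV. (1 - 2 * r) / 4 * q i + r\<^sup>2 / 4 + (r - b) * (q i - p $ i))"
    by (intro sum_mono pointwise)
  also have "\<dots> = (1 - 2 * r) / 4 * real k + n * (r\<^sup>2 / 4)"
    unfolding sum.distrib sum_distrib_left[symmetric] sum_subtractf sum_q sum_p by (simp add: n_def)
  also have "\<dots> = real k * (1 - real k / n) / 4"
    using n by (simp add: r_def power2_eq_square field_simps)
  finally show ?thesis using assms(1) by (simp add: n_def field_simps)
qed

section \<open>Attainment of the worst case\<close>

lemma compact_review_matrices: "compact (review_matrices :: (real^'m^'n) set)"
  unfolding compact_eq_bounded_closed
proof
  have "norm X \<le> (\<Sum>i\<in>(UNIV :: 'n set). \<Sum>j\<in>(UNIV :: 'm set). 1)"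
    if "X \<in> review_matrices" for X :: "real^'m^'n"
  proof -
    have "norm X \<le> (\<Sum>i\<in>UNIV. norm (X $ i))"
      by (simp add: norm_vec_def L2_set_le_sum)
    also have "\<dots> \<le> (\<Sum>i\<in>UNIV. \<Sum>j\<in>UNIV. \<bar>X $ i $ j\<bar>)"
      by (intro sum_mono norm_le_l1_cart)
    also have "\<dots> \<le> (\<Sum>i\<in>(UNIV :: 'n set). \<Sum>j\<in>(UNIV :: 'm set). 1)"
      using that by (intro sum_mono) (auto simp: review_matrices_def abs_le_iff)
    finally show ?thesis .
  qed
  then show "bounded (review_matrices :: (real^'m^'n) set)" by (auto simp: bounded_iff)
  show "closed (review_matrices :: (real^'m^'n) set)"
    unfolding review_matrices_def atLeastAtMost_iff
    by (intro closed_Collect_all closed_Collect_conj closed_Collect_le continuous_intros)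
qed

text \<open>The Euclidean norm is at most \<open>norm1\<close>, and \<open>norm11\<close> is
  continuous, so the Lipschitz bound squeezes \<open>u Y - u X\<close> to 0.\<close>

lemma continuous_on_lipschitz_utility:
  fixes u :: "real^'m^'n \<Rightarrow> real^'n"
  assumes "lipschitz_utility lam u"
  shows "continuous_on review_matrices u"
  unfolding continuous_on_def
proof (intro ballI)
  fix X :: "real^'m^'n" assume X: "X \<in> review_matrices"
  have "((\<lambda>Y. lam * norm11 (Y - X)) \<longlongrightarrow> lam * norm11 (X - X)) (at X within review_matrices)"
    unfolding norm11_def by (intro tendsto_intros)
  then have lim: "((\<lambda>Y. lam * norm11 (Y - X)) \<longlongrightarrow> 0) (at X within review_matrices)"
    by (simp add: norm11_def)
  have "norm (u Y - u X) \<le> lam * norm11 (Y - X)" if "Y \<in> review_matrices" for Y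
    using norm_le_l1_cart[of "u Y - u X"] assms that X
    unfolding lipschitz_utility_def norm1_def by fastforce
  then have "((\<lambda>Y. u Y - u X) \<longlongrightarrow> 0) (at X within review_matrices)"
    by (intro Lim_null_comparison[OF _ lim]) (simp add: eventually_at_filter)
  then show "(u \<longlongrightarrow> u X) (at X within review_matrices)" by (rule Lim_null[THEN iffD2])
qed

text \<open>Intercepts are chosen separately for each matrix and need not vary continuously; the
  bound of \<open>clipped_lipschitz\<close> does not involve them.\<close>

lemma continuous_on_inclusion_probs:
  fixes u :: "real^'m^'n \<Rightarrow> real^'n"
  assumes "0 \<le> L / (2 * lam)" and "continuous_on review_matrices u"
    and "clipped_linear_lottery u lam L k rule"
  shows "continuous_on review_matrices (\<lambda>X. inclusion_probs (rule X))"
  unfolding continuous_on_def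
proof (intro ballI)
  let ?a = "L / (2 * lam)" and ?p = "\<lambda>X. inclusion_probs (rule X)"
  fix X :: "real^'m^'n" assume X: "X \<in> review_matrices"
  have "((\<lambda>Y. ?a * norm (u Y - u X)) \<longlongrightarrow> ?a * norm (u X - u X)) (at X within review_matrices)"
    using assms(2) X unfolding continuous_on_def by (intro tendsto_intros) auto
  then have lim: "((\<lambda>Y. ?a * norm (u Y - u X)) \<longlongrightarrow> 0) (at X within review_matrices)" by simp
  have "norm (?p Y - ?p X) \<le> ?a * norm (u Y - u X)" if Y: "Y \<in> review_matrices" for Y
  proof -
    obtain b where b: "(\<Sum>i\<in>UNIV. clip01 (?a * u X $ i + b)) = real k"
      "\<And>i. ?p X $ i = clip01 (?a * u X $ i + b)"
      using assms(3) X unfolding clipped_linear_lottery_def by blast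
    obtain c where c: "(\<Sum>i\<in>UNIV. clip01 (?a * u Y $ i + c)) = real k"
      "\<And>i. ?p Y $ i = clip01 (?a * u Y $ i + c)"
      using assms(3) Y unfolding clipped_linear_lottery_def by blast
    show ?thesis
      using assms(1) c(2) b(2) by (rule clipped_lipschitz) (simp only: b c)
  qed
  then have "((\<lambda>Y. ?p Y - ?p X) \<longlongrightarrow> 0) (at X within review_matrices)"
    by (intro Lim_null_comparison[OF _ lim]) (simp add: eventually_at_filter)
  then show "(?p \<longlongrightarrow> ?p X) (at X within review_matrices)" by (rule Lim_null[THEN iffD2])
qed

theorem theorem2:
  fixes u :: "real^'m^'n \<Rightarrow> real^'n"
    and rule :: "real^'m^'n \<Rightarrow> 'n set pmf"
    and k :: nat and lam L :: real
  assumes "1 \<le> k" and "k \<le> CARD('n)"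
    and "0 < lam" and "0 < L"
    and "lipschitz_utility lam u"
    and "clipped_linear_lottery u lam L k rule"
  shows "\<exists>X0\<in>review_matrices.
           (\<forall>X\<in>review_matrices. regret u k rule X \<le> regret u k rule X0) \<and>
           regret u k rule X0 \<le> real k * (1 - real k / real CARD('n)) * lam / (2 * L)"
proof -
  let ?R = "review_matrices :: (real^'m^'n) set"
  have u: "continuous_on ?R u"
    using assms(5) by (rule continuous_on_lipschitz_utility)
  have p: "continuous_on ?R (\<lambda>X. inclusion_probs (rule X))"
    using assms u by (intro continuous_on_inclusion_probs) auto
  have "continuous_on ?R (\<lambda>X. sum_largest k (u X))"
    by (rule continuous_on_compose2[OF continuous_on_sum_largest[OF assms(2)] u subset_UNIV])
  then have "continuous_on ?R (regret u k rule)"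
    unfolding regret_def[abs_def] using u p by (intro continuous_intros)
  moreover have "(0 :: real^'m^'n) \<in> ?R" by (simp add: review_matrices_def)
  ultimately obtain X0 where X0: "X0 \<in> ?R" "\<forall>X\<in>?R. regret u k rule X \<le> regret u k rule X0"
    using continuous_attains_sup[OF compact_review_matrices] by blast
  obtain b where b: "(\<Sum>i\<in>UNIV. clip01 (L / (2 * lam) * u X0 $ i + b)) = real k"
    "\<And>i. inclusion_probs (rule X0) $ i = clip01 (L / (2 * lam) * u X0 $ i + b)"
    using assms(6) X0(1) unfolding clipped_linear_lottery_def by blast
  obtain T where T: "card T = k" "sum_largest k (u X0) = (\<Sum>i\<in>T. u X0 $ i)"
    using sum_largest_attained[OF assms(2)] by metis
  \<comment> \<open>The bound for slope \<open>a = L / (2 * lam)\<close>, where \<open>4 * a\<close>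
    equals \<open>2 * L / lam\<close>.\<close>
  have "regret u k rule X0 \<le> real k * (1 - real k / real CARD('n)) / (4 * (L / (2 * lam)))"
    unfolding regret_def T(2) using assms(3,4) T(1) b
    by (intro clipped_regret_bound) auto
  also have "\<dots> = real k * (1 - real k / real CARD('n)) * lam / (2 * L)"
    by simp
  finally show ?thesis using X0 by blast
qed

end
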